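(* Let $F=f+h$ be as in the context, suppose $f$ is H\"older smooth with exponent $\nu\in[0,1]$ and constant $L_\nu>0$, and let $\rho>0$, $\bar x\in\operatorname{dom}F$. Consider the sequence generated by ProxBundle with center $\bar x$ and parameter $\rho$ (run without termination), and let $\delta_j$ be the proximal-value gap at inner iteration $j$. Then $$\delta_{j+1}\le\delta_j-\frac{\rho}{2}\,G_\nu\,\delta_{j+1}^{\frac{2}{1+\nu}},\qquad\forall j\ge0,$$ where $G_\nu=\left(\frac{L_\nu}{1+\nu}\right)^{-\frac{2}{1+\nu}}$.
   Context: Problem. $F=f+h$ on $\mathbb{R}^n$, where $f:\mathbb{R}^n\to\mathbb{R}$ is finite-valued and convex and $h:\mathbb{R}^n\to\mathbb{R}\cup\{+\infty\}$ is proper, lower semicontinuous and convex; $F$ attains its minimum. $\partial$ is the convex subdifferential, $\|\cdot\|$ the Euclidean norm. H\"older smoothness with exponent $\nu\in[0,1]$ and constant $L_\nu$: $\|g_x-g_y\|\le L_\nu\|x-y\|^\nu$ for all $x,y\in\mathbb{R}^n$ and all $g_x\in\partial f(x)$, $g_y\in\partial f(y)$ (for $\nu=0$ the right-hand side is $L_0$). ProxBundle with center $\bar x\in\operatorname{dom}F$ and parameter $\rho>0$. Set $z_0=\bar x$. For $j=0,1,2,\dots$: choose any convex model $f_j:\mathbb{R}^n\to\mathbb{R}$ such that (1) $f_j(x)\le f(x)$ for all $x$; (2) for some $g_j\in\partial f(z_j)$, $f_j(x)\ge f(z_j)+\langle g_j,x-z_j\rangle$ for all $x$; (3) if $j\ge1$,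 there exist $a_j\in\partial f_{j-1}(z_j)$ and $b_j\in\partial h(z_j)$ with $a_j+b_j=\rho(\bar x-z_j)$ such that $f_j(x)\ge f_{j-1}(z_j)+\langle a_j,x-z_j\rangle$ for all $x$. Let $F_j=f_j+h$ and $z_{j+1}=\arg\min_x\{F_j(x)+\frac{\rho}{2}\|x-\bar x\|^2\}$. Quantities: $F_{1/\rho}(\bar x)=\min_x\{F(x)+\frac{\rho}{2}\|x-\bar x\|^2\}$, $m_j=\min_x\{F_j(x)+\frac{\rho}{2}\|x-\bar x\|^2\}$, and the proximal-value gap $\delta_j=F_{1/\rho}(\bar x)-m_j$ (which is nonnegative). *)

theory Defs
  imports "HOL-Analysis.Analysis"
begin

text \<open>
  Functions with values in the reals extended by \<open>+\<infinity>\<close> are \<^typ>\<open>ereal\<close>-valued; the value \<open>-\<infinity>\<close>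
  is excluded by properness. A finite-valued \<open>f\<close> is passed to extended-valued notions
  as \<open>\<lambda>x. ereal (f x)\<close>.
\<close>

definition eff_domain :: "('a \<Rightarrow> ereal) \<Rightarrow> 'a set" where
  "eff_domain \<phi> = {x. \<phi> x < \<infinity>}"

definition proper_fun :: "('a \<Rightarrow> ereal) \<Rightarrow> bool" where
  "proper_fun \<phi> \<longleftrightarrow> (\<forall>x. \<phi> x \<noteq> -\<infinity>) \<and> eff_domain \<phi> \<noteq> {}"

definition lsc_fun :: "('a::topological_space \<Rightarrow> ereal) \<Rightarrow> bool" where
  "lsc_fun \<phi> \<longleftrightarrow> (\<forall>x. \<phi> x \<le> Liminf (at x) \<phi>)"

text \<open>
  Only meaningful for functions that avoid \<open>-\<infinity>\<close>. The convention \<open>0 * \<infinity> = 0\<close> of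
  \<^typ>\<open>ereal\<close> makes the cases \<open>u = 0\<close> and \<open>v = 0\<close> trivial, as they should be.
\<close>

definition convex_fun :: "('a::real_vector \<Rightarrow> ereal) \<Rightarrow> bool" where
  "convex_fun \<phi> \<longleftrightarrow>
     (\<forall>x y. \<forall>u\<ge>0. \<forall>v\<ge>0. u + v = 1 \<longrightarrow>
        \<phi> (u *\<^sub>R x + v *\<^sub>R y) \<le> ereal u * \<phi> x + ereal v * \<phi> y)"

text \<open>For proper \<open>\<phi>\<close> this set is empty outside the effective domain.\<close>

definition subdifferential :: "('a::real_inner \<Rightarrow> ereal) \<Rightarrow> 'a \<Rightarrow> 'a set" where
  "subdifferential \<phi> x = {g. \<forall>y. \<phi> x + ereal (g \<bullet> (y - x)) \<le> \<phi> y}"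

text \<open>
  The case \<open>\<nu> = 0\<close> is separate because \<open>0 powr 0 = 0\<close>, whereas the bound is to be
  \<open>L\<close> for \<open>x = y\<close> as well.
\<close>

definition holder_smooth :: "real \<Rightarrow> real \<Rightarrow> ('a::real_inner \<Rightarrow> real) \<Rightarrow> bool" where
  "holder_smooth \<nu> L f \<longleftrightarrow>
     (\<forall>x y. \<forall>gx \<in> subdifferential (\<lambda>x. ereal (f x)) x.
            \<forall>gy \<in> subdifferential (\<lambda>x. ereal (f x)) y.
        norm (gx - gy) \<le> (if \<nu> = 0 then L else L * norm (x - y) powr \<nu>))"

definition add_fun :: "('a \<Rightarrow> real) \<Rightarrow> ('a \<Rightarrow> ereal) \<Rightarrow> 'a \<Rightarrow> ereal" where
  "add_fun f h x = ereal (f x) + h x"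

definition prox_objective :: "('a::real_inner \<Rightarrow> ereal) \<Rightarrow> real \<Rightarrow> 'a \<Rightarrow> 'a \<Rightarrow> ereal" where
  "prox_objective \<phi> \<rho> c x = \<phi> x + ereal (\<rho> / 2 * (norm (x - c))\<^sup>2)"

text \<open>
  The minimum value of the proximal subproblem, that is, the Moreau envelope of \<open>\<phi>\<close> with
  parameter \<open>1/\<rho>\<close> at \<open>c\<close>. For \<open>\<rho> > 0\<close> and \<open>\<phi>\<close> proper, lower semicontinuous and convex on a
  Euclidean space the infimum is attained.
\<close>

definition prox_value :: "('a::real_inner \<Rightarrow> ereal) \<Rightarrow> real \<Rightarrow> 'a \<Rightarrow> ereal" where
  "prox_value \<phi> \<rho> c = (INF x. prox_objective \<phi> \<rho> c x)"

text \<open>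
  \<open>prox_bundle f h \<rho> c m z\<close>: the models \<open>m\<close> and the points \<open>z\<close> form an infinite run of
  ProxBundle with center \<open>c\<close>; the models are any that satisfy the requirements. The
  minimizer is unique by strong convexity, so being a minimizer determines \<open>z (Suc j)\<close>.
\<close>

definition prox_bundle ::
  "('a::real_inner \<Rightarrow> real) \<Rightarrow> ('a \<Rightarrow> ereal) \<Rightarrow> real \<Rightarrow> 'a \<Rightarrow> (nat \<Rightarrow> 'a \<Rightarrow> real) \<Rightarrow> (nat \<Rightarrow> 'a) \<Rightarrow> bool"
where
  "prox_bundle f h \<rho> c m z \<longleftrightarrow>
     z 0 = c \<and>
     (\<forall>j. convex_on UNIV (m j)) \<and>
     (\<forall>j x. m j x \<le> f x) \<and>
     (\<forall>j. \<exists>g \<in> subdifferential (\<lambda>x. ereal (f x)) (z j).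
        \<forall>x. m j x \<ge> f (z j) + g \<bullet> (x - z j)) \<and>
     (\<forall>j\<ge>1. \<exists>a \<in> subdifferential (\<lambda>x. ereal (m (j - 1) x)) (z j).
        \<exists>b \<in> subdifferential h (z j).
          a + b = \<rho> *\<^sub>R (c - z j) \<and>
          (\<forall>x. m j x \<ge> m (j - 1) (z j) + a \<bullet> (x - z j))) \<and>
     (\<forall>j. is_arg_min (prox_objective (add_fun (m j) h) \<rho> c) (\<lambda>_. True) (z (Suc j)))"

text \<open>
  Both values are finite when \<open>f + h\<close> has a minimizer, \<open>h\<close> is proper, \<open>c\<close> lies in the effective
  domain and the subproblem with model \<open>mj\<close> has a minimizer, so the conversion to
  \<^typ>\<open>real\<close> loses nothing.
\<close>

definition prox_gap ::
  "('a::real_inner \<Rightarrow> real) \<Rightarrow> ('a \<Rightarrow> ereal) \<Rightarrow> real \<Rightarrow> 'a \<Rightarrow> ('a \<Rightarrow> real) \<Rightarrow> real" where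
  "prox_gap f h \<rho> c mj =
     real_of_ereal (prox_value (add_fun f h) \<rho> c - prox_value (add_fun mj h) \<rho> c)"

end

theory Submission
  imports Defs "HOL-Real_Asymp.Real_Asymp"
begin

text \<open>
  Write \<open>d\<close> for the distance between consecutive iterates \<open>z\<^sub>j\<^sub>+\<^sub>1\<close> and \<open>z\<^sub>j\<^sub>+\<^sub>2\<close>. The aggregate cut
  makes the next proximal objective at least the current minimum plus \<open>\<rho>/2\<close> times the squared
  distance to \<open>z\<^sub>j\<^sub>+\<^sub>1\<close>, so the gap drops by at least \<open>\<rho>/2 * d\<^sup>2\<close>. The gradient cut at \<open>z\<^sub>j\<^sub>+\<^sub>1\<close> and
  Hoelder smoothness bound the new model error at \<open>z\<^sub>j\<^sub>+\<^sub>2\<close>, hence the new gap, by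
  \<open>L/(1+\<nu>) * d powr (1+\<nu>)\<close>. Eliminating \<open>d\<close> gives the recursion.
\<close>

section \<open>The descent inequality under Hoelder smoothness\<close>

lemma subdifferential_real_iff:
  "g \<in> subdifferential (\<lambda>x. ereal (f x)) x \<longleftrightarrow> (\<forall>y. f x + g \<bullet> (y - x) \<le> f y)"
  by (simp add: subdifferential_def)

text \<open>Separate the point \<open>(x, f x)\<close> from the strict epigraph of \<open>f\<close>.\<close>

lemma subdifferential_nonempty:
  fixes f :: "'a::euclidean_space \<Rightarrow> real"
  assumes "convex_on UNIV f"
  shows "subdifferential (\<lambda>x. ereal (f x)) x \<noteq> {}"
proof -
  define S where "S = {(y, t). f y < t}"
  have "convex S"
  proof (rule convexI, safe)
    fix y s y' s' and u v :: real
    assume *: "(y, s) \<in> S" "(y', s') \<in> S" "0 \<le> u" "0 \<le> v" "u + v = 1"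
    have "f (u *\<^sub>R y + v *\<^sub>R y') \<le> u * f y + v * f y'"
      using assms * by (simp add: convex_on_def)
    also have "\<dots> < u * s + v * s'"
    \<comment> \<open>Strictness needs a positive weight: it comes from the first point unless
      \<open>u = 0\<close>, and then from the second, whose weight is 1.\<close>
    proof (cases "u = 0")
      case True
      then show ?thesis using * by (simp add: S_def)
    next
      case False
      then have "u * f y < u * s" "v * f y' \<le> v * s'"
        using * by (simp_all add: S_def mult_left_mono)
      then show ?thesis by simp
    qed
    finally show "u *\<^sub>R (y, s) + v *\<^sub>R (y', s') \<in> S" by (simp add: S_def)
  qed
  moreover have "(x, f x + 1) \<in> S" by (simp add: S_def)
  then have "S \<noteq> {}" by blast
  moreover have "{(x, f x)} \<inter> S = {}" by (auto simp: S_def)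
  ultimately obtain a \<beta> where "a \<noteq> 0" and a: "a \<bullet> (x, f x) \<le> \<beta>" "\<forall>p\<in>S. \<beta> \<le> a \<bullet> p"
    using separating_hyperplane_sets[of "{(x, f x)}" S] by auto
  obtain u s where us: "a = (u, s)" by (cases a)
  have sep: "s * (f x - t) \<le> u \<bullet> (y - x)" if "f y < t" for y t
  proof -
    have "u \<bullet> x + s * f x \<le> u \<bullet> y + s * t"
      using a that by (force simp: us S_def)
    then show ?thesis by (simp add: algebra_simps)
  qed
  have "s \<ge> 0" using sep[of x "f x + 1"] by simp
  \<comment> \<open>The hyperplane is not vertical because \<open>f\<close> is finite everywhere:
    testing at \<open>x - u\<close> would force \<open>u = 0\<close> and hence
    \<open>a = 0\<close>.\<close>
  moreover have "s \<noteq> 0"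
  proof
    assume "s = 0"
    with sep[of "x - u" "f (x - u) + 1"] have "u \<bullet> u \<le> 0" by simp
    then have "u = 0" by (metis inner_gt_zero_iff not_le)
    with \<open>s = 0\<close> \<open>a \<noteq> 0\<close> us show False by (simp add: zero_prod_def)
  qed
  ultimately have "s > 0" by simp
  \<comment> \<open>Dividing by \<open>s\<close> turns the normal into a subgradient. The strict
    epigraph only admits heights above \<open>f y\<close>, hence the slack \<open>e\<close>.\<close>
  have "f x + (- (1 / s) *\<^sub>R u) \<bullet> (y - x) \<le> f y" for y
  proof (rule field_le_epsilon)
    fix e :: real assume "e > 0"
    then have "s * (f x - (f y + e)) \<le> u \<bullet> (y - x)" by (intro sep[of y "f y + e"]) linarith
    with \<open>s > 0\<close> have "f x - (f y + e) \<le> (u \<bullet> (y - x)) / s"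
      by (simp only: pos_le_divide_eq mult.commute)
    then show "f x + (- (1 / s) *\<^sub>R u) \<bullet> (y - x) \<le> f y + e" by simp
  qed
  then show ?thesis unfolding ex_in_conv[symmetric] subdifferential_real_iff by blast
qed

text \<open>Integral comparison: by the mean value theorem \<open>real k powr \<nu>\<close> is at
  most the increment of \<open>t powr (1 + \<nu>) / (1 + \<nu>)\<close> from \<open>k\<close> to
  \<open>k + 1\<close>, and these increments telescope.\<close>

lemma sum_powr_le:
  fixes \<nu> :: real
  assumes "0 \<le> \<nu>"
  shows "(\<Sum>k=1..N. real k powr \<nu>) \<le> (real N + 1) powr (1 + \<nu>) / (1 + \<nu>)"
proof (induction N)
  case (Suc N)
  define t where "t = real (Suc N)"
  have "t > 0" by (simp add: t_def)
  have "\<exists>\<xi>>t. \<xi> < t + 1 \<and> (t + 1) powr (1 + \<nu>) - t powr (1 + \<nu>)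
      = (t + 1 - t) * ((1 + \<nu>) * \<xi> powr \<nu>)"
    using \<open>t > 0\<close> by (intro MVT2) (auto intro!: derivative_eq_intros simp: powr_diff)
  then obtain \<xi> where "\<xi> > t"
    "(t + 1) powr (1 + \<nu>) - t powr (1 + \<nu>) = (1 + \<nu>) * \<xi> powr \<nu>" by auto
  moreover have "t powr \<nu> \<le> \<xi> powr \<nu>"
    using \<open>t > 0\<close> \<open>\<xi> > t\<close> assms by (intro powr_mono2) auto
  then have "(1 + \<nu>) * t powr \<nu> \<le> (1 + \<nu>) * \<xi> powr \<nu>"
    using assms by (intro mult_left_mono) auto
  ultimately have "t powr \<nu> \<le> ((t + 1) powr (1 + \<nu>) - t powr (1 + \<nu>)) / (1 + \<nu>)"
    using assms by (simp add: field_simps)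
  with Suc show ?case by (simp add: t_def diff_divide_distrib add_ac)
qed (use assms in simp)

text \<open>
  Telescoping the subgradient inequality along \<open>N\<close> equidistant points of the segment bounds the
  linearization error by a Riemann sum of \<open>\<integral> t powr \<nu>\<close>, which converges as \<open>N \<longlonglongrightarrow> \<infinity>\<close>.
\<close>

lemma holder_smooth_descent:
  fixes f :: "'a::euclidean_space \<Rightarrow> real"
  assumes convex: "convex_on UNIV f" and "0 \<le> \<nu>" "0 \<le> L" and holder: "holder_smooth \<nu> L f"
    and g: "g \<in> subdifferential (\<lambda>x. ereal (f x)) x"
  shows "f y - f x - g \<bullet> (y - x) \<le> L / (1 + \<nu>) * norm (y - x) powr (1 + \<nu>)"
proof (cases "y = x")
  case False
  define D where "D = norm (y - x)"
  have "D > 0" using False by (simp add: D_def)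
  have bound: "f y - f x - g \<bullet> (y - x)
      \<le> L / (1 + \<nu>) * D powr (1 + \<nu>) * ((real N + 1) / real N) powr (1 + \<nu>)" if "N > 0" for N
  proof -
    define w where "w = (1 / real N) *\<^sub>R (y - x)"
    define p where "p k = x + real k *\<^sub>R w" for k :: nat
    have norm_w: "norm w = D / N" using that by (simp add: w_def D_def divide_inverse)
    \<comment> \<open>A subgradient at the far endpoint \<open>p (Suc k)\<close> bounds the
      increment from above; it is compared with \<open>g\<close> over the distance
      \<open>real (Suc k) * norm w\<close>.\<close>
    have step: "f (p (Suc k)) - f (p k) - g \<bullet> w
        \<le> L * (D / N) powr (1 + \<nu>) * real (Suc k) powr \<nu>" for k
    proof -
      obtain g' where g': "g' \<in> subdifferential (\<lambda>x. ereal (f x)) (p (Suc k))"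
        using subdifferential_nonempty[OF convex] by blast
      have "p k - p (Suc k) = - w" by (simp add: p_def algebra_simps)
      then have "f (p (Suc k)) - f (p k) \<le> g' \<bullet> w"
        using g'[unfolded subdifferential_real_iff, rule_format, of "p k"] by simp
      then have "f (p (Suc k)) - f (p k) - g \<bullet> w \<le> (g' - g) \<bullet> w"
        by (simp add: inner_diff_left)
      also have "\<dots> \<le> norm (g' - g) * norm w" by (rule norm_cauchy_schwarz)
      also have "norm (g' - g) \<le> L * (real (Suc k) * norm w) powr \<nu>"
      proof -
        have "p (Suc k) - x = real (Suc k) *\<^sub>R w" by (simp add: p_def)
        \<comment> \<open>A positive base makes the power 1 when \<open>\<nu> = 0\<close>, so both
          branches of \<open>holder_smooth\<close> yield the same bound.\<close>
        moreover have "norm w > 0" using norm_w \<open>D > 0\<close> that by simp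
        ultimately show ?thesis
          using holder g' g unfolding holder_smooth_def
          by (fastforce split: if_splits)
      qed
      also have "(real (Suc k) * norm w) powr \<nu> = real (Suc k) powr \<nu> * (D / N) powr \<nu>"
        unfolding norm_w using \<open>D > 0\<close> by (intro powr_mult)
      also have "L * (real (Suc k) powr \<nu> * (D / N) powr \<nu>) * norm w
          = L * (D / N) powr (1 + \<nu>) * real (Suc k) powr \<nu>"
        using \<open>D > 0\<close> that by (simp only: norm_w powr_add) simp
      finally show ?thesis by (simp add: mult_right_mono)
    qed
    have "N *\<^sub>R w = y - x" using that by (simp add: w_def)
    then have "p N = y" "p 0 = x" by (simp_all add: p_def)
    then have "f y - f x - g \<bullet> (y - x) = (\<Sum>k<N. f (p (Suc k)) - f (p k) - g \<bullet> w)"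
      using \<open>N *\<^sub>R w = y - x\<close> sum_lessThan_telescope[of "\<lambda>k. f (p k)" N]
      by (simp add: sum_subtractf flip: inner_scaleR_right)
    also have "\<dots> \<le> (\<Sum>k<N. L * (D / N) powr (1 + \<nu>) * real (Suc k) powr \<nu>)"
      by (intro sum_mono step)
    also have "\<dots> = L * (D / N) powr (1 + \<nu>) * (\<Sum>k=1..N. real k powr \<nu>)"
      by (simp add: sum_distrib_left sum.atLeast1_atMost_eq)
    also have "\<dots> \<le> L * (D / N) powr (1 + \<nu>) * ((real N + 1) powr (1 + \<nu>) / (1 + \<nu>))"
      using assms by (intro mult_left_mono sum_powr_le) auto
    also have "\<dots> = L / (1 + \<nu>) * D powr (1 + \<nu>) * ((real N + 1) / N) powr (1 + \<nu>)"
      using \<open>D > 0\<close> by (simp add: powr_divide)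
    finally show ?thesis .
  qed
  have "(\<lambda>N::nat. (real N + 1) / real N) \<longlonglongrightarrow> 1" by real_asymp
  then have "(\<lambda>N. L / (1 + \<nu>) * D powr (1 + \<nu>) * ((real N + 1) / real N) powr (1 + \<nu>))
      \<longlonglongrightarrow> L / (1 + \<nu>) * D powr (1 + \<nu>) * 1 powr (1 + \<nu>)"
    by (intro tendsto_intros) auto
  then show ?thesis
    by (intro tendsto_lowerbound[OF _ eventually_mono[OF eventually_gt_at_top[of 0] bound]])
      (simp_all add: D_def)
qed simp

section \<open>The proximal subproblems\<close>

lemma prox_value_eq:
  assumes "is_arg_min (prox_objective \<phi> \<rho> c) (\<lambda>_. True) w"
  shows "prox_value \<phi> \<rho> c = prox_objective \<phi> \<rho> c w"
  using assms unfolding prox_value_def is_arg_min_def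
  by (intro antisym INF_lower INF_greatest) (auto simp: not_less)

text \<open>For a model below \<open>f\<close> this makes the proximal-value gap
  nonnegative.\<close>

lemma prox_value_add_fun_mono:
  assumes "\<And>x. m x \<le> f x"
  shows "prox_value (add_fun m h) \<rho> c \<le> prox_value (add_fun f h) \<rho> c"
  unfolding prox_value_def prox_objective_def add_fun_def
  by (intro INF_mono') (use assms in \<open>auto intro!: add_right_mono\<close>)

text \<open>An infinite value at the minimizer would lose against any point of the effective domain
  of \<open>h\<close>.\<close>

lemma finite_at_prox_arg_min:
  assumes "proper_fun h" "is_arg_min (prox_objective (add_fun m h) \<rho> c) (\<lambda>_. True) w"
  obtains r where "h w = ereal r"
proof -
  obtain y where y: "h y < \<infinity>"
    using assms(1) by (auto simp: proper_fun_def eff_domain_def)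
  have "prox_objective (add_fun m h) \<rho> c w \<le> prox_objective (add_fun m h) \<rho> c y"
    using assms(2) by (auto simp: is_arg_min_def not_less)
  with y have "h w \<noteq> \<infinity>"
    by (cases "h y") (auto simp: prox_objective_def add_fun_def)
  moreover have "h w \<noteq> -\<infinity>" using assms(1) by (simp add: proper_fun_def)
  ultimately show ?thesis using that by (cases "h w") auto
qed

text \<open>Completing the square uses that \<open>a + b\<close> is the negative gradient of the proximal term at \<open>w\<close>.\<close>

lemma prox_objective_cut:
  fixes c :: "'a::real_inner"
  assumes "b \<in> subdifferential h w" "h w = ereal r" "a + b = \<rho> *\<^sub>R (c - w)"
    and "t \<ge> q + a \<bullet> (x - w)" and "h x = ereal s"
  shows "q + r + \<rho> / 2 * (norm (w - c))\<^sup>2 + \<rho> / 2 * (norm (x - w))\<^sup>2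
    \<le> t + s + \<rho> / 2 * (norm (x - c))\<^sup>2"
proof -
  have "ereal r + ereal (b \<bullet> (x - w)) \<le> ereal s"
    using assms(1) unfolding subdifferential_def assms(2,5)[symmetric] by simp
  moreover have "(a + b) \<bullet> (x - w) + \<rho> / 2 * (norm (x - c))\<^sup>2
      = \<rho> / 2 * (norm (w - c))\<^sup>2 + \<rho> / 2 * (norm (x - w))\<^sup>2"
    unfolding assms(3) power2_norm_eq_inner
    by (simp add: inner_diff_left inner_diff_right inner_commute field_simps)
  ultimately show ?thesis using assms(4) by (simp add: inner_add_left)
qed

lemma powr_elim_distance:
  fixes \<nu> :: real
  assumes "0 \<le> \<nu>" "0 < K" "0 \<le> d" "0 \<le> \<delta>" "\<delta> \<le> K * d powr (1 + \<nu>)"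
  shows "K powr (- (2 / (1 + \<nu>))) * \<delta> powr (2 / (1 + \<nu>)) \<le> d\<^sup>2"
proof -
  have "K powr (- (2 / (1 + \<nu>))) * \<delta> powr (2 / (1 + \<nu>)) = (\<delta> / K) powr (2 / (1 + \<nu>))"
    using assms by (simp add: powr_divide powr_minus_divide)
  also have "\<dots> \<le> (d powr (1 + \<nu>)) powr (2 / (1 + \<nu>))"
    using assms by (intro powr_mono2) (auto simp: field_simps)
  also have "\<dots> = d powr 2"
  proof -
    have "(1 + \<nu>) * (2 / (1 + \<nu>)) = 2" using assms(1) by (simp add: field_simps)
    then show ?thesis by (simp only: powr_powr)
  qed
  also have "\<dots> = d\<^sup>2" using assms(3) by simp
  finally show ?thesis .
qed

theorem lemma4:
  fixes f :: "real ^ 'n \<Rightarrow> real"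
    and h :: "real ^ 'n \<Rightarrow> ereal"
    and \<nu> L \<rho> :: real
    and xbar :: "real ^ 'n"
    and fm :: "nat \<Rightarrow> real ^ 'n \<Rightarrow> real"
    and z :: "nat \<Rightarrow> real ^ 'n"
  assumes "convex_on UNIV f"
    and "proper_fun h" and "lsc_fun h" and "convex_fun h"
    and "\<exists>x. is_arg_min (add_fun f h) (\<lambda>_. True) x"
    and "0 \<le> \<nu>" and "\<nu> \<le> 1" and "0 < L" and "holder_smooth \<nu> L f"
    and "0 < \<rho>" and "xbar \<in> eff_domain (add_fun f h)"
    and "prox_bundle f h \<rho> xbar fm z"
  shows "\<forall>j. prox_gap f h \<rho> xbar (fm (Suc j))
      \<le> prox_gap f h \<rho> xbar (fm j)
         - \<rho> / 2 * (L / (1 + \<nu>)) powr (- (2 / (1 + \<nu>)))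
             * prox_gap f h \<rho> xbar (fm (Suc j)) powr (2 / (1 + \<nu>))"
proof
  fix j
  define w where "w = z (Suc j)"
  define w' where "w' = z (Suc (Suc j))"
  have below: "fm i x \<le> f x" for i x
    using assms(12) by (simp add: prox_bundle_def)
  have argmin: "is_arg_min (prox_objective (add_fun (fm i) h) \<rho> xbar) (\<lambda>_. True) (z (Suc i))" for i
    using assms(12) by (simp add: prox_bundle_def)
  obtain g where g: "g \<in> subdifferential (\<lambda>x. ereal (f x)) w"
    and g_cut: "\<And>x. fm (Suc j) x \<ge> f w + g \<bullet> (x - w)"
    using assms(12) unfolding prox_bundle_def w_def by blast
  \<comment> \<open>The aggregate cut of model \<open>Suc j\<close> is taken at \<open>w\<close>,
    the minimizer for model \<open>j\<close>; \<open>Suc j - 1\<close> is kept to match the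
    definition and simplified afterwards.\<close>
  have "\<exists>a \<in> subdifferential (\<lambda>x. ereal (fm (Suc j - 1) x)) (z (Suc j)).
        \<exists>b \<in> subdifferential h (z (Suc j)). a + b = \<rho> *\<^sub>R (xbar - z (Suc j)) \<and>
          (\<forall>x. fm (Suc j) x \<ge> fm (Suc j - 1) (z (Suc j)) + a \<bullet> (x - z (Suc j)))"
    using assms(12)[unfolded prox_bundle_def, THEN conjunct2, THEN conjunct2, THEN conjunct2,
        THEN conjunct2, THEN conjunct1, THEN spec[of _ "Suc j"]]
    by (rule mp) simp
  then obtain a b where ab: "b \<in> subdifferential h w" "a + b = \<rho> *\<^sub>R (xbar - w)"
    and a_cut: "\<And>x. fm (Suc j) x \<ge> fm j w + a \<bullet> (x - w)"
    by (auto simp: w_def)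
  obtain r where r: "h w = ereal r"
    using finite_at_prox_arg_min[OF assms(2) argmin] unfolding w_def by blast
  obtain r' where r': "h w' = ereal r'"
    using finite_at_prox_arg_min[OF assms(2) argmin] unfolding w'_def by blast
  define M where "M = fm j w + r + \<rho> / 2 * (norm (w - xbar))\<^sup>2"
  define M' where "M' = fm (Suc j) w' + r' + \<rho> / 2 * (norm (w' - xbar))\<^sup>2"
  define d where "d = norm (w' - w)"
  have val: "prox_value (add_fun (fm j) h) \<rho> xbar = ereal M"
    unfolding prox_value_eq[OF argmin] by (simp add: prox_objective_def add_fun_def M_def r flip: w_def)
  have val': "prox_value (add_fun (fm (Suc j)) h) \<rho> xbar = ereal M'"
    unfolding prox_value_eq[OF argmin]
    by (simp add: prox_objective_def add_fun_def M'_def r' flip: w'_def)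
  \<comment> \<open>Testing at \<open>w'\<close> bounds the envelope from above; with the lower
    bound \<open>M'\<close> it is finite.\<close>
  have "prox_value (add_fun f h) \<rho> xbar \<le> prox_objective (add_fun f h) \<rho> xbar w'"
    unfolding prox_value_def by (rule INF_lower) simp
  then have le: "prox_value (add_fun f h) \<rho> xbar \<le> ereal (f w' + r' + \<rho> / 2 * (norm (w' - xbar))\<^sup>2)"
    by (simp add: prox_objective_def add_fun_def r')
  have ge: "ereal M' \<le> prox_value (add_fun f h) \<rho> xbar"
    using prox_value_add_fun_mono[of "fm (Suc j)" f h \<rho> xbar] below val' by simp
  obtain V where V: "prox_value (add_fun f h) \<rho> xbar = ereal V"
    using le ge by (cases "prox_value (add_fun f h) \<rho> xbar") auto
  have gap: "prox_gap f h \<rho> xbar (fm j) = V - M"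
    and gap': "prox_gap f h \<rho> xbar (fm (Suc j)) = V - M'"
    by (simp_all add: prox_gap_def V val val')
  have drop: "M + \<rho> / 2 * d\<^sup>2 \<le> M'"
    unfolding M_def M'_def d_def by (rule prox_objective_cut[OF ab(1) r ab(2) a_cut r'])
  \<comment> \<open>At \<open>w'\<close> the values of \<open>h\<close> and the proximal terms
    cancel, leaving only the model error.\<close>
  have "V - M' \<le> f w' - fm (Suc j) w'" using le by (simp add: V M'_def)
  also have "\<dots> \<le> f w' - f w - g \<bullet> (w' - w)" using g_cut[of w'] by simp
  also have "\<dots> \<le> L / (1 + \<nu>) * d powr (1 + \<nu>)"
    unfolding d_def using assms g by (intro holder_smooth_descent) auto
  finally have "(L / (1 + \<nu>)) powr (- (2 / (1 + \<nu>))) * (V - M') powr (2 / (1 + \<nu>)) \<le> d\<^sup>2"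
    using assms ge V by (intro powr_elim_distance) (auto simp: d_def)
  then have "\<rho> / 2 * ((L / (1 + \<nu>)) powr (- (2 / (1 + \<nu>))) * (V - M') powr (2 / (1 + \<nu>)))
      \<le> \<rho> / 2 * d\<^sup>2"
    using assms by (intro mult_left_mono) auto
  with drop show "prox_gap f h \<rho> xbar (fm (Suc j))
      \<le> prox_gap f h \<rho> xbar (fm j)
         - \<rho> / 2 * (L / (1 + \<nu>)) powr (- (2 / (1 + \<nu>)))
             * prox_gap f h \<rho> xbar (fm (Suc j)) powr (2 / (1 + \<nu>))"
    unfolding gap gap' by (simp add: mult.assoc)
qed

end
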